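(* Let $A,B_1,\ldots,B_m\in\mathcal{M}_D^{\mathrm{sym}}$, $\gamma_1,\ldots,\gamma_m\in\mathbb{R}$, $\epsilon>0$, and let $S$ be any real $d\times D$ matrix. Let $\eta\in\mathbb{R}$ satisfy $\eta\ge\operatorname{Tr}(X^* )$ for an optimal point $X^*$ of the sketchable SDP defined by $A,B_i,\gamma_i$, and let $\alpha(0)$ be the value of this SDP. Assume that there exists a positive definite $X_0>0$ such that all the constraints of the sketchable SDP are strictly satisfied, i.e. $\operatorname{Tr}(B_iX_0)<\gamma_i$ for all $i\in\{1,\ldots,m\}$, and that the dual problem is feasible. Then the value $\alpha_S$ of the sketched SDP is bounded by $$\alpha_S\ \le\ \alpha(0)+C\,\|y^*\|_1 ,$$ where $y^*$ is an optimal solution to the dual problem and $$C=\max\{\,3\epsilon\eta\|B_i\|_1 \ :\ i\in\{1,\ldots,m\}\,\}.$$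
   Context: $\mathcal{M}_D^{\mathrm{sym}}$ is the set of real symmetric $D\times D$ matrices; $X\ge0$ means that the symmetric matrix $X$ is positive semidefinite. $\|B\|_1=\operatorname{Tr}[(B^TB)^{1/2}]$ is the Schatten $1$-norm of a matrix; for a vector $y\in\mathbb{R}^m$, $\|y\|_1=\sum_i|y_i|$. The sketchable SDP is: maximize $\operatorname{Tr}(AX)$ subject to $\operatorname{Tr}(B_iX)\le\gamma_i$ for $i=1,\ldots,m$, and $X\ge0$, over $X\in\mathcal{M}_D^{\mathrm{sym}}$. Its dual problem is: minimize $\langle c,\gamma\rangle=\sum_i c_i\gamma_i$ subject to $\sum_{i=1}^m c_iB_i-A\ge0$ and $c\in\mathbb{R}^m$ with $c_i\ge 0$ for all $i$. The sketched SDP is: maximize $\operatorname{Tr}(SAS^TY)$ subject to $\operatorname{Tr}(SB_iS^TY)\le\gamma_i+3\epsilon\eta\|B_i\|_1$ for $i=1,\ldots,m$, and $Y\ge0$, over $Y\in\mathcal{M}_d^{\mathrm{sym}}$. The value of a maximization problem is the supremum of its objective over feasible points. *)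

theory Defs
  imports "HOL-Analysis.Analysis"
begin

definition psd :: "real^'n^'n \<Rightarrow> bool" where
  "psd X \<longleftrightarrow> transpose X = X \<and> (\<forall>v. 0 \<le> v \<bullet> (X *v v))"

definition pos_definite :: "real^'n^'n \<Rightarrow> bool" where
  "pos_definite X \<longleftrightarrow> transpose X = X \<and> (\<forall>v. v \<noteq> 0 \<longrightarrow> 0 < v \<bullet> (X *v v))"

text \<open>A positive semidefinite matrix has exactly one positive semidefinite square root, so the
  description below is proper whenever \<open>psd M\<close> holds; it is only applied to \<open>B\<^sup>T B\<close>.\<close>

definition psd_sqrt :: "real^'n^'n \<Rightarrow> real^'n^'n" where
  "psd_sqrt M = (THE R. psd R \<and> R ** R = M)"

definition schatten1_norm :: "real^'n^'m \<Rightarrow> real" where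
  "schatten1_norm B = trace (psd_sqrt (transpose B ** B))"

definition l1_norm :: "real^'m \<Rightarrow> real" where
  "l1_norm y = (\<Sum>i\<in>UNIV. \<bar>y $ i\<bar>)"

text \<open>The constraints are indexed by the finite type \<open>'m\<close>. The value is taken in \<^typ>\<open>ereal\<close>, so
  that it is \<open>-\<infinity>\<close> for an infeasible and \<open>\<infinity>\<close> for an unbounded problem.\<close>

definition sdp_feasible :: "('m::finite \<Rightarrow> real^'n^'n) \<Rightarrow> real^'m \<Rightarrow> (real^'n^'n) set" where
  "sdp_feasible B \<gamma> = {X. psd X \<and> (\<forall>i. trace (B i ** X) \<le> \<gamma> $ i)}"

definition sdp_value ::
    "real^'n^'n \<Rightarrow> ('m::finite \<Rightarrow> real^'n^'n) \<Rightarrow> real^'m \<Rightarrow> ereal" where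
  "sdp_value A B \<gamma> = (SUP X\<in>sdp_feasible B \<gamma>. ereal (trace (A ** X)))"

definition sdp_optimal ::
    "real^'n^'n \<Rightarrow> ('m::finite \<Rightarrow> real^'n^'n) \<Rightarrow> real^'m \<Rightarrow> real^'n^'n \<Rightarrow> bool" where
  "sdp_optimal A B \<gamma> X \<longleftrightarrow>
     X \<in> sdp_feasible B \<gamma> \<and> (\<forall>X'\<in>sdp_feasible B \<gamma>. trace (A ** X') \<le> trace (A ** X))"

definition dual_feasible ::
    "real^'n^'n \<Rightarrow> ('m::finite \<Rightarrow> real^'n^'n) \<Rightarrow> (real^'m) set" where
  "dual_feasible A B = {c. psd ((\<Sum>i\<in>UNIV. c $ i *\<^sub>R B i) - A) \<and> (\<forall>i. 0 \<le> c $ i)}"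

definition dual_optimal ::
    "real^'n^'n \<Rightarrow> ('m::finite \<Rightarrow> real^'n^'n) \<Rightarrow> real^'m \<Rightarrow> real^'m \<Rightarrow> bool" where
  "dual_optimal A B \<gamma> c \<longleftrightarrow>
     c \<in> dual_feasible A B \<and> (\<forall>c'\<in>dual_feasible A B. c \<bullet> \<gamma> \<le> c' \<bullet> \<gamma>)"

definition sketch :: "real^'D^'d \<Rightarrow> real^'D^'D \<Rightarrow> real^'d^'d" where
  "sketch S M = S ** M ** transpose S"

definition sketched_sdp_value ::
    "real^'D^'d \<Rightarrow> real \<Rightarrow> real \<Rightarrow> real^'D^'D \<Rightarrow> ('m::finite \<Rightarrow> real^'D^'D) \<Rightarrow> real^'m \<Rightarrow> ereal" where
  "sketched_sdp_value S \<epsilon> \<eta> A B \<gamma> =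
     sdp_value (sketch S A) (\<lambda>i. sketch S (B i))
       (\<chi> i. \<gamma> $ i + 3 * \<epsilon> * \<eta> * schatten1_norm (B i))"

end

theory Submission
  imports Defs
begin

text \<open>By Slater's condition, separating the optimal point from the convex set of attainable
  (constraint slack, objective) pairs gives a dual point whose value is at most the primal one;
  with weak duality it is dual optimal and there is no duality gap. A dual feasible point of the
  sketchable SDP stays dual feasible for the sketched SDP, because congruence by \<open>S\<close> preserves
  positive semidefiniteness. Weak duality for the sketched SDP, whose constraint bounds have grown
  by \<open>3 \<epsilon> \<eta> \<parallel>B\<^sub>i\<parallel>\<^sub>1\<close>, then gives the bound. Both uses of weak duality rest on
  \<open>Tr (P Q) \<ge> 0\<close> for positive semidefinite \<open>P\<close> and \<open>Q\<close>.\<close>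

section \<open>Transposes, rank-one matrices and traces\<close>

definition outer :: "real^'n \<Rightarrow> real^'n^'n" where
  "outer u = (\<chi> i j. u $ i * u $ j)"

lemma transpose_add: "transpose (A + B) = transpose A + transpose (B :: real^'n^'m)"
  by (simp add: transpose_def vec_eq_iff)

lemma transpose_diff: "transpose (A - B) = transpose A - transpose (B :: real^'n^'m)"
  by (simp add: transpose_def vec_eq_iff)

lemma transpose_sum: "transpose (\<Sum>i\<in>I. f i) = (\<Sum>i\<in>I. transpose (f i :: real^'n^'m))"
  by (simp add: transpose_def vec_eq_iff)

lemma transpose_outer: "transpose (outer u) = outer u"
  by (simp add: transpose_def outer_def vec_eq_iff mult.commute)

lemma outer_mult_vec: "outer u *v x = (u \<bullet> x) *\<^sub>R u"
  by (simp add: outer_def matrix_vector_mult_def vec_eq_iff inner_vec_def sum_distrib_left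
      mult.commute mult.left_commute)

lemma trace_scaleR: "trace (c *\<^sub>R M) = c * trace (M :: real^'n^'n)"
  by (simp add: trace_def sum_distrib_left)

text \<open>The bridge between trace pairings and quadratic forms. It serves twice: to evaluate the
  rank-one terms split off from a psd matrix, and to test the dual slack matrix against a single
  vector.\<close>

lemma trace_matrix_mul_outer: "trace (P ** outer u) = u \<bullet> (P *v u)"
  by (simp add: trace_def outer_def matrix_matrix_mult_def matrix_vector_mult_def inner_vec_def
      sum_distrib_left mult.commute mult.left_commute)

lemma matrix_add_rdistrib: "(A + B) ** C = A ** C + B ** (C :: real^'k^'n)"
  by (simp add: matrix_matrix_mult_def vec_eq_iff distrib_right sum.distrib)

lemma linear_trace_mul: "linear (\<lambda>M :: real^'n^'n. trace (M ** X))"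
  by (rule linearI) (simp_all add: matrix_add_rdistrib trace_add trace_scaleR
      scalar_matrix_assoc[symmetric])

lemma trace_lincomb_diff_mul:
  fixes B :: "'i \<Rightarrow> real^'n^'n"
  shows "trace (((\<Sum>i\<in>I. c i *\<^sub>R B i) - A) ** X) = (\<Sum>i\<in>I. c i * trace (B i ** X)) - trace (A ** X)"
  by (simp add: linear_diff[OF linear_trace_mul] linear_sum[OF linear_trace_mul]
      linear_scale[OF linear_trace_mul])

section \<open>The psd cone and congruence by the sketching matrix\<close>

lemma psd_0: "psd 0"
  by (simp add: psd_def transpose_def vec_eq_iff)

lemma psd_add: "psd X \<Longrightarrow> psd Y \<Longrightarrow> psd (X + Y)"
  by (simp add: psd_def transpose_add matrix_vector_mult_add_rdistrib inner_add_right)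

lemma psd_scaleR: "psd X \<Longrightarrow> 0 \<le> c \<Longrightarrow> psd (c *\<^sub>R X)"
  by (simp add: psd_def transpose_scalar scaleR_matrix_vector_assoc[symmetric])

lemma psd_outer: "psd (outer u)"
  by (simp add: psd_def transpose_outer outer_mult_vec inner_commute)

lemma pos_definite_imp_psd: "pos_definite X \<Longrightarrow> psd X"
  by (metis inner_zero_left less_le order_refl pos_definite_def psd_def)

lemma psd_sketch:
  fixes S :: "real^'n^'d"
  assumes "psd M"
  shows "psd (sketch S M)"
proof -
  have "v \<bullet> (sketch S M *v v) = (transpose S *v v) \<bullet> (M *v (transpose S *v v))" for v
    by (simp only: sketch_def matrix_vector_mul_assoc[symmetric] dot_lmul_matrix[symmetric]
        transpose_matrix_vector)
  then show ?thesis
    using assms by (simp add: psd_def) (simp add: sketch_def matrix_transpose_mul matrix_mul_assoc)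
qed

lemma sketch_lincomb_diff:
  fixes S :: "real^'n^'d" and B :: "'i \<Rightarrow> real^'n^'n"
  shows "sketch S ((\<Sum>i\<in>I. c i *\<^sub>R B i) - A) = (\<Sum>i\<in>I. c i *\<^sub>R sketch S (B i)) - sketch S A"
proof -
  have "linear (sketch S)"
    by (rule linearI) (simp_all add: sketch_def matrix_add_ldistrib matrix_add_rdistrib
        scalar_matrix_assoc[symmetric] matrix_scalar_ac)
  then show ?thesis
    by (simp add: linear_diff linear_sum linear_scale)
qed

section \<open>Nonnegativity of the trace pairing on the psd cone\<close>

lemma inner_symmetric_matrix:
  fixes Q :: "real^'n^'n"
  assumes "transpose Q = Q"
  shows "x \<bullet> (Q *v y) = y \<bullet> (Q *v x)"
  by (metis assms dot_lmul_matrix inner_commute vector_transpose_matrix)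

lemma inner_axis_matrix: "axis i 1 \<bullet> (Q *v axis j 1) = (Q :: real^'n^'n) $ i $ j"
  by (simp add: inner_axis' matrix_vector_mul_component inner_axis)

lemma psd_diag_nonneg: "psd Q \<Longrightarrow> 0 \<le> Q $ i $ i"
  by (metis inner_axis_matrix psd_def)

text \<open>With vanishing diagonal, the quadratic form at
  \<open>axis i 1 + t *\<^sub>R axis j 1\<close> collapses to \<open>2 * t * Q $ i $ j\<close>. This
  is linear in \<open>t\<close>, and nonnegativity at 1 and at -1 forces the entry to
  vanish.\<close>

lemma psd_zero_diag_imp_zero:
  assumes Q: "psd Q" and diag: "\<And>i. Q $ i $ i = 0"
  shows "Q = 0"
proof -
  have "Q $ i $ j = 0" for i j
  proof -
    have sym: "Q $ j $ i = Q $ i $ j"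
      using Q by (metis inner_axis_matrix inner_symmetric_matrix psd_def)
    have "0 \<le> (axis i 1 + t *\<^sub>R axis j 1) \<bullet> (Q *v (axis i 1 + t *\<^sub>R axis j 1))" for t
      using Q by (simp add: psd_def)
    then have "0 \<le> 2 * t * Q $ i $ j" for t
      by (simp add: matrix_vector_right_distrib matrix_vector_mult_scaleR inner_add_left
          inner_add_right inner_axis_matrix diag sym)
    from this[of 1] this[of "-1"] show ?thesis by simp
  qed
  then show ?thesis by (simp add: vec_eq_iff)
qed

text \<open>One Cholesky step: it clears the diagonal entry \<open>Q $ k $ k\<close>.\<close>

lemma psd_cholesky_step:
  fixes Q :: "real^'n^'n"
  assumes Q: "psd Q" and pos: "0 < Q $ k $ k"
  defines "q \<equiv> Q *v axis k 1"
  shows "psd (Q - (1 / Q $ k $ k) *\<^sub>R outer q)"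
proof -
  let ?a = "Q $ k $ k"
  have sym: "transpose Q = Q" using Q by (simp add: psd_def)
  have "0 \<le> x \<bullet> ((Q - (1 / ?a) *\<^sub>R outer q) *v x)" for x
  proof -
    \<comment> \<open>\<open>?t\<close> minimizes the quadratic form of \<open>Q\<close> over the
      line \<open>x - t *\<^sub>R axis k 1\<close>. Completing the square shows that this minimum is
      the form of the reduced matrix at \<open>x\<close>, which is therefore nonnegative.\<close>
    let ?t = "(x \<bullet> q) / ?a"
    let ?w = "x - ?t *\<^sub>R axis k 1"
    have kq: "axis k 1 \<bullet> q = ?a" by (simp add: q_def inner_axis_matrix)
    have kx: "axis k 1 \<bullet> (Q *v x) = x \<bullet> q"
      unfolding q_def by (rule inner_symmetric_matrix[OF sym])
    have "?w \<bullet> (Q *v ?w) = x \<bullet> (Q *v x) - (x \<bullet> q)\<^sup>2 / ?a"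
      using pos kq kx
      by (simp add: matrix_vector_mult_diff_distrib matrix_vector_mult_scaleR inner_diff_left
          inner_diff_right flip: q_def) (simp add: field_simps power2_eq_square)
    also have "\<dots> = x \<bullet> ((Q - (1 / ?a) *\<^sub>R outer q) *v x)"
      by (simp add: matrix_vector_mult_diff_rdistrib scaleR_matrix_vector_assoc[symmetric]
          outer_mult_vec inner_diff_right power2_eq_square inner_commute)
    finally show ?thesis
      using Q by (metis psd_def)
  qed
  then show ?thesis
    by (simp add: psd_def transpose_diff transpose_scalar transpose_outer sym)
qed

text \<open>Cholesky elimination as an induction on the number of nonzero diagonal entries of
  \<open>Q\<close>. Each step splits off a positive multiple of some \<open>outer q\<close>, whose
  trace against \<open>P\<close> is a value of the quadratic form of \<open>P\<close>; when the
  diagonal is exhausted, the remaining matrix is zero.\<close>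

lemma trace_psd_mul_nonneg:
  assumes P: "psd P" and "psd Q"
  shows "0 \<le> trace (P ** Q)"
  using \<open>psd Q\<close>
proof (induction "card {k. Q $ k $ k \<noteq> 0}" arbitrary: Q rule: less_induct)
  case less
  show ?case
  proof (cases "\<forall>k. Q $ k $ k = 0")
    case True
    then show ?thesis
      using psd_zero_diag_imp_zero[OF less.prems] by (simp add: trace_def)
  next
    case False
    then obtain k where pos: "0 < Q $ k $ k"
      using psd_diag_nonneg[OF less.prems] by (metis less_le)
    define q where "q = Q *v axis k 1"
    define R where "R = Q - (1 / Q $ k $ k) *\<^sub>R outer q"
    have R: "psd R"
      unfolding R_def q_def by (rule psd_cholesky_step[OF less.prems pos])
    have diagR: "R $ j $ j = Q $ j $ j - (q $ j)\<^sup>2 / Q $ k $ k" for j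
      by (simp add: R_def outer_def power2_eq_square)
    have "q $ k = Q $ k $ k"
      by (simp add: q_def matrix_vector_mul_component inner_axis)
    then have "R $ k $ k = 0"
      using pos by (simp add: diagR power2_eq_square)
    \<comment> \<open>The step only lowers diagonal entries, and those of the psd matrix
      \<open>R\<close> cannot become negative, so old zeros persist. Together with the new zero at
      \<open>k\<close> this makes the induction measure drop strictly.\<close>
    moreover have "R $ j $ j = 0" if "Q $ j $ j = 0" for j
      using psd_diag_nonneg[OF R, of j] that pos diagR[of j]
        divide_nonneg_pos[OF zero_le_power2 pos, of "q $ j"] by linarith
    ultimately have "{j. R $ j $ j \<noteq> 0} \<subset> {j. Q $ j $ j \<noteq> 0}"
      using less_imp_neq[OF pos] by (intro psubsetI) (blast, metis (mono_tags, lifting) mem_Collect_eq)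
    then have "0 \<le> trace (P ** R)"
      using less.hyps[OF _ R] by (simp add: psubset_card_mono)
    moreover have "trace (P ** Q) = trace (P ** (R + (1 / Q $ k $ k) *\<^sub>R outer q))"
      by (simp add: R_def)
    then have "trace (P ** Q) = trace (P ** R) + (1 / Q $ k $ k) * (q \<bullet> (P *v q))"
      by (simp only: matrix_add_ldistrib matrix_scalar_ac scalar_matrix_assoc[symmetric] trace_add
          trace_scaleR trace_matrix_mul_outer)
    ultimately show ?thesis
      using P pos by (simp add: psd_def)
  qed
qed

section \<open>Weak duality and dual feasibility under sketching\<close>

lemma sdp_weak_duality:
  assumes c: "c \<in> dual_feasible A B" and X: "X \<in> sdp_feasible B \<gamma>"
  shows "trace (A ** X) \<le> c \<bullet> \<gamma>"
proof -
  have "0 \<le> trace (((\<Sum>i\<in>UNIV. c $ i *\<^sub>R B i) - A) ** X)"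
    using c X by (intro trace_psd_mul_nonneg) (auto simp: dual_feasible_def sdp_feasible_def)
  then have "trace (A ** X) \<le> (\<Sum>i\<in>UNIV. c $ i * trace (B i ** X))"
    by (simp add: trace_lincomb_diff_mul)
  also have "\<dots> \<le> (\<Sum>i\<in>UNIV. c $ i * \<gamma> $ i)"
    using c X by (intro sum_mono mult_left_mono) (auto simp: dual_feasible_def sdp_feasible_def)
  finally show ?thesis by (simp add: inner_vec_def)
qed

lemma dual_feasible_sketch:
  "c \<in> dual_feasible A B \<Longrightarrow> c \<in> dual_feasible (sketch S A) (\<lambda>i. sketch S (B i))"
  by (auto simp: dual_feasible_def simp flip: sketch_lincomb_diff intro: psd_sketch)

section \<open>Lagrange multipliers and strong duality\<close>

lemma affine_nonneg_imp_slope_nonneg: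
  fixes a b :: real
  assumes "\<And>s. 0 \<le> s \<Longrightarrow> 0 \<le> b + s * a"
  shows "0 \<le> a"
proof (rule ccontr)
  assume "\<not> 0 \<le> a"
  \<comment> \<open>With \<open>a < 0\<close>, the chosen point gives the value
    \<open>b - \<bar>b\<bar> - 1\<close>, which is negative.\<close>
  then show False
    using assms[of "(\<bar>b\<bar> + 1) / - a"] by (simp add: divide_nonneg_neg)
qed

text \<open>The multiplier is the normal of a hyperplane separating \<open>(0, ?p)\<close> from the
  attainable pairs, rescaled so that the objective has coefficient -1. Slater's condition guarantees
  that the hyperplane is not vertical, so that the rescaling is possible.\<close>

lemma slater_lagrange_multiplier:
  fixes B :: "'m::finite \<Rightarrow> real^'n^'n" and \<gamma> :: "real^'m"
  assumes opt: "sdp_optimal A B \<gamma> X\<^sub>s"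
    and X0: "psd X\<^sub>0" "\<And>i. trace (B i ** X\<^sub>0) < \<gamma> $ i"
  obtains c where "\<And>i. 0 \<le> c $ i"
    and "\<And>X. psd X \<Longrightarrow>
      trace (A ** X) \<le> trace (A ** X\<^sub>s) + (\<Sum>i\<in>UNIV. c $ i * (trace (B i ** X) - \<gamma> $ i))"
proof -
  let ?p = "trace (A ** X\<^sub>s)"
  \<comment> \<open>\<open>K\<close> is closed under raising \<open>u\<close> and lowering
    \<open>t\<close>, which later fixes the signs of the normal. The strict inequality in the
    objective keeps \<open>(0, ?p)\<close> outside \<open>K\<close>, because
    \<open>X\<^sub>s\<close> is optimal.\<close>
  define K :: "((real^'m) \<times> real) set"
    where "K = {(u, t). \<exists>X. psd X \<and> (\<forall>i. trace (B i ** X) - \<gamma> $ i \<le> u $ i) \<and> t < trace (A ** X)}"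
  have memK: "(u, t) \<in> K"
    if "psd X" "\<And>i. trace (B i ** X) - \<gamma> $ i \<le> u $ i" "t < trace (A ** X)" for X u t
    using that by (auto simp: K_def)
  have "convex K"
  proof (rule convexI)
    fix x y :: "(real^'m) \<times> real" and a b :: real
    assume xy: "x \<in> K" "y \<in> K" and ab: "0 \<le> a" "0 \<le> b" "a + b = 1"
    obtain u t v s where x: "x = (u, t)" and y: "y = (v, s)" by (metis surj_pair)
    obtain X where X: "psd X" "\<And>i. trace (B i ** X) - \<gamma> $ i \<le> u $ i" "t < trace (A ** X)"
      using xy(1) unfolding K_def x by blast
    obtain Y where Y: "psd Y" "\<And>i. trace (B i ** Y) - \<gamma> $ i \<le> v $ i" "s < trace (A ** Y)"
      using xy(2) unfolding K_def y by blast
    have tr: "trace (M ** (a *\<^sub>R X + b *\<^sub>R Y)) = a * trace (M ** X) + b * trace (M ** Y)"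
      for M :: "real^'n^'n"
      by (simp add: matrix_add_ldistrib matrix_scalar_ac scalar_matrix_assoc[symmetric] trace_add
          trace_scaleR)
    have "(a *\<^sub>R u + b *\<^sub>R v, a * t + b * s) \<in> K"
    proof (rule memK)
      show "psd (a *\<^sub>R X + b *\<^sub>R Y)"
        using X Y ab by (intro psd_add psd_scaleR)
      show "trace (B i ** (a *\<^sub>R X + b *\<^sub>R Y)) - \<gamma> $ i \<le> (a *\<^sub>R u + b *\<^sub>R v) $ i" for i
      proof -
        have "a * (trace (B i ** X) - \<gamma> $ i) + b * (trace (B i ** Y) - \<gamma> $ i)
            \<le> a * u $ i + b * v $ i"
          using X Y ab by (intro add_mono mult_left_mono)
        moreover have "a * \<gamma> $ i + b * \<gamma> $ i = \<gamma> $ i"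
          using ab by (simp flip: distrib_right)
        ultimately show ?thesis
          by (simp add: tr algebra_simps)
      qed
      show "a * t + b * s < trace (A ** (a *\<^sub>R X + b *\<^sub>R Y))"
      \<comment> \<open>Strictness has to come from a point with positive weight: from
        \<open>Y\<close> if \<open>a = 0\<close>, since then \<open>b = 1\<close>, and from
        \<open>X\<close> otherwise.\<close>
      proof (cases "a = 0")
        case True
        then show ?thesis using ab Y by (simp add: tr)
      next
        case False
        then have "a * t < a * trace (A ** X)" using X ab by simp
        moreover have "b * s \<le> b * trace (A ** Y)" using Y ab by (simp add: mult_left_mono)
        ultimately show ?thesis by (simp add: tr)
      qed
    qed
    then show "a *\<^sub>R x + b *\<^sub>R y \<in> K" by (simp add: x y)
  qed
  moreover have "K \<noteq> {}"
  proof -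
    have "(\<chi> i. trace (B i ** X\<^sub>0) - \<gamma> $ i, trace (A ** X\<^sub>0) - 1) \<in> K"
      using X0 by (intro memK) auto
    then show ?thesis by blast
  qed
  moreover have "(0, ?p) \<notin> K"
    using opt by (force simp: K_def sdp_optimal_def sdp_feasible_def)
  ultimately obtain l \<tau> \<beta> where sep0: "(l, \<tau>) \<noteq> 0" "(l, \<tau>) \<bullet> (0, ?p) \<le> \<beta>"
    and sepK: "\<And>z. z \<in> K \<Longrightarrow> \<beta> \<le> (l, \<tau>) \<bullet> z"
    using separating_hyperplane_sets[of "{(0, ?p)}" K] by auto
  have sep: "\<tau> * ?p \<le> l \<bullet> u + \<tau> * t" if "(u, t) \<in> K" for u t
    using sepK[OF that] sep0(2) by simp
  define u\<^sub>0 where "u\<^sub>0 = (\<chi> i. trace (B i ** X\<^sub>0) - \<gamma> $ i)"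
  \<comment> \<open>Raising the \<open>i\<close>-th coordinate of \<open>u\<^sub>0\<close> without
    bound stays inside \<open>K\<close>, so the separating functional cannot decrease in that
    direction.\<close>
  have l: "0 \<le> l $ i" for i
  proof -
    have "0 \<le> (l \<bullet> u\<^sub>0 + \<tau> * (trace (A ** X\<^sub>0) - 1) - \<tau> * ?p) + s * l $ i" if "0 \<le> s" for s
    proof -
      have "(u\<^sub>0 + s *\<^sub>R axis i 1, trace (A ** X\<^sub>0) - 1) \<in> K"
        using X0 that by (intro memK[of X\<^sub>0]) (auto simp: u\<^sub>0_def axis_def)
      from sep[OF this] show ?thesis by (simp add: inner_add_right inner_axis)
    qed
    then show ?thesis by (rule affine_nonneg_imp_slope_nonneg)
  qed
  \<comment> \<open>The same ray argument, now lowering the objective coordinate.\<close>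
  have "0 \<le> - \<tau>"
  proof -
    have "0 \<le> (l \<bullet> u\<^sub>0 + \<tau> * (trace (A ** X\<^sub>0) - 1) - \<tau> * ?p) + s * - \<tau>" if "0 \<le> s" for s
    proof -
      have "(u\<^sub>0, trace (A ** X\<^sub>0) - 1 - s) \<in> K"
        using X0 that by (intro memK[of X\<^sub>0]) (auto simp: u\<^sub>0_def)
      from sep[OF this] show ?thesis by (simp add: algebra_simps)
    qed
    then show ?thesis by (rule affine_nonneg_imp_slope_nonneg)
  qed
  \<comment> \<open>A vertical hyperplane would have a nonzero normal \<open>l\<close> with
    nonnegative entries. All entries of \<open>u\<^sub>0\<close> are negative, so
    \<open>l \<bullet> u\<^sub>0 < 0\<close>, whereas separation at the Slater point demands
    \<open>0 \<le> l \<bullet> u\<^sub>0\<close>.\<close>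
  moreover have "\<tau> \<noteq> 0"
  proof
    assume "\<tau> = 0"
    then obtain i where "l $ i \<noteq> 0" using sep0(1) by (auto simp: vec_eq_iff zero_prod_def)
    then have "0 < l $ i" using l[of i] by simp
    have u0: "u\<^sub>0 $ j < 0" for j
      using X0(2) by (simp add: u\<^sub>0_def)
    have "(\<Sum>j\<in>UNIV. l $ j * u\<^sub>0 $ j) < (\<Sum>j\<in>(UNIV :: 'm set). 0)"
    proof (rule sum_strict_mono_ex1)
      show "\<forall>j\<in>UNIV. l $ j * u\<^sub>0 $ j \<le> 0"
        using l u0 by (simp add: mult_nonneg_nonpos less_imp_le)
      show "\<exists>j\<in>UNIV. l $ j * u\<^sub>0 $ j < 0"
        using \<open>0 < l $ i\<close> u0[of i] by (blast intro: mult_pos_neg)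
    qed simp
    moreover have "(u\<^sub>0, trace (A ** X\<^sub>0) - 1) \<in> K"
      using X0 by (intro memK[of X\<^sub>0]) (auto simp: u\<^sub>0_def)
    ultimately show False
      using sep \<open>\<tau> = 0\<close> by (fastforce simp: inner_vec_def)
  qed
  ultimately have \<tau>: "\<tau> < 0" by simp
  show ?thesis
  proof (rule that[of "(1 / - \<tau>) *\<^sub>R l"])
    show "0 \<le> ((1 / - \<tau>) *\<^sub>R l) $ i" for i
      using l[of i] \<tau> by (simp add: divide_simps)
    fix X :: "real^'n^'n"
    assume X: "psd X"
    let ?u = "\<chi> i. trace (B i ** X) - \<gamma> $ i"
    \<comment> \<open>Membership in \<open>K\<close> only reaches values strictly below
      \<open>trace (A ** X)\<close>; \<open>dense_le\<close> then passes to the supremum.\<close>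
    have "t \<le> ?p + (1 / - \<tau>) * (l \<bullet> ?u)" if "t < trace (A ** X)" for t
    proof -
      have "(?u, t) \<in> K" using X that by (intro memK[of X]) auto
      from sep[OF this] show ?thesis using \<tau> by (simp add: field_simps)
    qed
    then have "trace (A ** X) \<le> ?p + (1 / - \<tau>) * (l \<bullet> ?u)"
      by (rule dense_le)
    then show "trace (A ** X)
        \<le> ?p + (\<Sum>i\<in>UNIV. ((1 / - \<tau>) *\<^sub>R l) $ i * (trace (B i ** X) - \<gamma> $ i))"
      by (simp add: inner_vec_def sum_distrib_left mult.assoc sum_divide_distrib sum_negf)
  qed
qed

text \<open>The Lagrangian inequality holds on the whole psd cone, so it can be probed there:
  unbounded multiples of rank-one matrices force the dual slack \<open>?M\<close> to be psd, and
  \<open>X = 0\<close> bounds the dual value by the primal one. Weak duality supplies the reverse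
  inequality and hence dual optimality.\<close>

lemma sdp_strong_duality:
  fixes B :: "'m::finite \<Rightarrow> real^'n^'n" and \<gamma> :: "real^'m"
  assumes sym: "transpose A = A" "\<And>i. transpose (B i) = B i"
    and opt: "sdp_optimal A B \<gamma> X\<^sub>s"
    and slater: "psd X\<^sub>0" "\<And>i. trace (B i ** X\<^sub>0) < \<gamma> $ i"
  obtains c where "dual_optimal A B \<gamma> c" "c \<bullet> \<gamma> = trace (A ** X\<^sub>s)"
proof -
  obtain c where c: "\<And>i. 0 \<le> c $ i"
    and lagrange: "\<And>X. psd X \<Longrightarrow>
      trace (A ** X) \<le> trace (A ** X\<^sub>s) + (\<Sum>i\<in>UNIV. c $ i * (trace (B i ** X) - \<gamma> $ i))"
    using slater_lagrange_multiplier[OF opt slater] by blast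
  let ?M = "(\<Sum>i\<in>UNIV. c $ i *\<^sub>R B i) - A"
  have bound: "c \<bullet> \<gamma> \<le> trace (A ** X\<^sub>s) + trace (?M ** X)" if "psd X" for X
    using lagrange[OF that]
    by (simp add: trace_lincomb_diff_mul right_diff_distrib sum_subtractf inner_vec_def)
  have "0 \<le> v \<bullet> (?M *v v)" for v
  proof (rule affine_nonneg_imp_slope_nonneg)
    fix s :: real
    assume "0 \<le> s"
    then have "psd (s *\<^sub>R outer v)"
      by (simp add: psd_scaleR psd_outer)
    moreover have "trace (?M ** (s *\<^sub>R outer v)) = s * (v \<bullet> (?M *v v))"
      by (simp only: matrix_scalar_ac scalar_matrix_assoc[symmetric] trace_scaleR
          trace_matrix_mul_outer)
    ultimately show "0 \<le> (trace (A ** X\<^sub>s) - c \<bullet> \<gamma>) + s * (v \<bullet> (?M *v v))"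
      using bound by fastforce
  qed
  then have feas: "c \<in> dual_feasible A B"
    using c sym by (simp add: dual_feasible_def psd_def transpose_diff transpose_sum transpose_scalar)
  have le: "c \<bullet> \<gamma> \<le> trace (A ** X\<^sub>s)"
    using bound[OF psd_0] by (simp add: trace_def)
  have ge: "trace (A ** X\<^sub>s) \<le> c' \<bullet> \<gamma>" if "c' \<in> dual_feasible A B" for c'
    using sdp_weak_duality[OF that] opt by (simp add: sdp_optimal_def)
  show ?thesis
  proof
    show "dual_optimal A B \<gamma> c"
      using feas le ge by (force simp: dual_optimal_def)
    show "c \<bullet> \<gamma> = trace (A ** X\<^sub>s)"
      using le ge[OF feas] by simp
  qed
qed

section \<open>Optimal values and enlarged constraint bounds\<close>

lemma sdp_optimal_value: "sdp_optimal A B \<gamma> X \<Longrightarrow> sdp_value A B \<gamma> = ereal (trace (A ** X))"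
  unfolding sdp_value_def sdp_optimal_def by (intro antisym SUP_least SUP_upper) auto

text \<open>Dual feasibility does not involve the constraint bounds, so \<open>y\<close> still
  certifies an upper bound after they move by \<open>\<delta>\<close>. The cost of the move is
  \<open>y \<bullet> \<delta>\<close>, and since \<open>y\<close> has nonnegative entries this is at
  most the largest entry of \<open>\<delta>\<close> times the sum of the entries of
  \<open>y\<close>.\<close>

lemma sdp_value_perturbed_le:
  fixes A :: "real^'n^'n" and y \<gamma> \<delta> :: "real^'m::finite"
  assumes y: "y \<in> dual_feasible A B"
  shows "sdp_value A B (\<gamma> + \<delta>) \<le> ereal (y \<bullet> \<gamma> + Max {\<delta> $ i | i. i \<in> UNIV} * l1_norm y)"
  unfolding sdp_value_def
proof (rule SUP_least)
  fix X assume "X \<in> sdp_feasible B (\<gamma> + \<delta>)"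
  from sdp_weak_duality[OF y this]
  have "trace (A ** X) \<le> y \<bullet> \<gamma> + (\<Sum>i\<in>UNIV. y $ i * \<delta> $ i)"
    by (simp add: inner_vec_def distrib_left sum.distrib)
  also have "(\<Sum>i\<in>UNIV. y $ i * \<delta> $ i)
      \<le> (\<Sum>i\<in>UNIV. \<bar>y $ i\<bar> * Max {\<delta> $ i | i. i \<in> UNIV})"
  proof (rule sum_mono)
    fix i
    have "\<delta> $ i \<le> Max {\<delta> $ i | i. i \<in> UNIV}"
      by (rule Max_ge) (auto simp: full_SetCompr_eq)
    moreover have "0 \<le> y $ i"
      using y by (simp add: dual_feasible_def)
    ultimately show "y $ i * \<delta> $ i \<le> \<bar>y $ i\<bar> * Max {\<delta> $ i | i. i \<in> UNIV}"
      by (simp add: mult_left_mono)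
  qed
  finally show "ereal (trace (A ** X))
      \<le> ereal (y \<bullet> \<gamma> + Max {\<delta> $ i | i. i \<in> UNIV} * l1_norm y)"
    by (simp add: l1_norm_def sum_distrib_right mult.commute)
qed

theorem theorem5p5:
  fixes A :: "real^'D^'D" and B :: "'m::finite \<Rightarrow> real^'D^'D" and \<gamma> :: "real^'m"
    and \<epsilon> \<eta> :: real and S :: "real^'D^'d" and X\<^sub>s :: "real^'D^'D"
  assumes "transpose A = A"
    and "\<And>i. transpose (B i) = B i"
    and "\<epsilon> > 0"
    and "sdp_optimal A B \<gamma> X\<^sub>s"
    and "\<eta> \<ge> trace X\<^sub>s"
    and "\<exists>X\<^sub>0. pos_definite X\<^sub>0 \<and> (\<forall>i. trace (B i ** X\<^sub>0) < \<gamma> $ i)"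
    and "dual_feasible A B \<noteq> {}"
  shows "(\<exists>y. dual_optimal A B \<gamma> y) \<and>
    (\<forall>y. dual_optimal A B \<gamma> y \<longrightarrow>
      sketched_sdp_value S \<epsilon> \<eta> A B \<gamma> \<le>
        sdp_value A B \<gamma> + ereal (Max {3 * \<epsilon> * \<eta> * schatten1_norm (B i) | i. i \<in> UNIV} * l1_norm y))"
proof (intro conjI allI impI)
  obtain X\<^sub>0 where X0: "psd X\<^sub>0" "\<And>i. trace (B i ** X\<^sub>0) < \<gamma> $ i"
    using assms(6) pos_definite_imp_psd by blast
  obtain c where c: "dual_optimal A B \<gamma> c" "c \<bullet> \<gamma> = trace (A ** X\<^sub>s)"
    using sdp_strong_duality[OF assms(1,2,4) X0] by blast
  then show "\<exists>y. dual_optimal A B \<gamma> y" by blast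
  fix y
  assume y: "dual_optimal A B \<gamma> y"
  let ?\<delta> = "\<chi> i. 3 * \<epsilon> * \<eta> * schatten1_norm (B i)"
  \<comment> \<open>An arbitrary dual optimum \<open>y\<close> does at least as well as the
    multiplier \<open>c\<close>, whose value equals the primal optimum.\<close>
  have "y \<bullet> \<gamma> \<le> trace (A ** X\<^sub>s)"
    using y c by (force simp: dual_optimal_def)
  moreover have "(\<chi> i. \<gamma> $ i + 3 * \<epsilon> * \<eta> * schatten1_norm (B i)) = \<gamma> + ?\<delta>"
    by (simp add: vec_eq_iff)
  then have "sketched_sdp_value S \<epsilon> \<eta> A B \<gamma>
      \<le> ereal (y \<bullet> \<gamma> + Max {?\<delta> $ i | i. i \<in> UNIV} * l1_norm y)"
    unfolding sketched_sdp_value_def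
    using y sdp_value_perturbed_le[OF dual_feasible_sketch[of y A B S], of \<gamma> ?\<delta>]
    by (simp add: dual_optimal_def)
  ultimately show "sketched_sdp_value S \<epsilon> \<eta> A B \<gamma> \<le> sdp_value A B \<gamma>
      + ereal (Max {3 * \<epsilon> * \<eta> * schatten1_norm (B i) | i. i \<in> UNIV} * l1_norm y)"
    by (simp add: sdp_optimal_value[OF assms(4)]) (erule order_trans, simp)
qed

end
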